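(* Let $M,D>0$ and let $L\in\mathbb{R}^{n\times n}$ be the Laplacian matrix of an undirected graph on $n$ nodes with positive edge weights. Consider the linearized swing dynamics $$\begin{bmatrix}\dot{\boldsymbol\theta}\\ \ddot{\boldsymbol\theta}\end{bmatrix}=\begin{bmatrix}\mathbf{0}_n & I_n\\ -\frac1M L & -\frac DM I_n\end{bmatrix}\begin{bmatrix}\boldsymbol\theta\\ \dot{\boldsymbol\theta}\end{bmatrix}+\begin{bmatrix}\mathbf{0}_n\\ \frac1M I_n\end{bmatrix}\mathbf{w}(t),$$ with $\boldsymbol\theta,\mathbf{w}$ taking values in $\mathbb{R}^n$, and with the frequency deviation output $\mathbf{y}=\dot{\boldsymbol\theta}$. Let $G$ be the transfer function from $\mathbf{w}$ to $\mathbf{y}$. Then: (i) the $\mathcal{H}_2$ norm is $\displaystyle \|G\|_2=\left(\frac{n}{2DM}\right)^{\frac12}$; (ii) the $\mathcal{H}_\infty$ norm is $\displaystyle \|G\|_\infty=\frac1D$.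
   Context: The Laplacian of an undirected graph with symmetric weights $B_{ij}>0$ on edges $\{i,j\}$ (no self-loops) is $L=\operatorname{diag}(d_1,\dots,d_n)-W$, where $W_{ij}=B_{ij}$ if $\{i,j\}$ is an edge and $0$ otherwise, and $d_i=\sum_j W_{ij}$. For a system $\dot x=Ax+F\mathbf{w}$, $\mathbf{y}=Cx$, the transfer function is $G(s)=C(sI-A)^{-1}F$, regarded as a matrix of rational functions (removable singularities are removed; in particular this is used at $s=0$, where $A$ is singular). The system norms are $$\|G\|_2=\left(\frac{1}{2\pi}\operatorname{trace}\int_{-\infty}^{\infty}G^*(j\omega)G(j\omega)\,d\omega\right)^{\frac12},\qquad \|G\|_\infty=\sup_{\omega\in\mathbb{R}}\lambda_{\max}^{\frac12}\big(G^*(j\omega)G(j\omega)\big),$$ where $j=\sqrt{-1}$ and $G^*(j\omega)$ is the conjugate transpose of $G(j\omega)$. *)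

theory Defs
  imports "HOL-Complex_Analysis.Complex_Analysis"
begin

definition weighted_graph :: "'n set set \<Rightarrow> ('n \<Rightarrow> 'n \<Rightarrow> real) \<Rightarrow> bool" where
  "weighted_graph E B \<longleftrightarrow>
     (\<forall>e\<in>E. card e = 2) \<and> (\<forall>i j. {i, j} \<in> E \<longrightarrow> B i j > 0 \<and> B i j = B j i)"

definition weight_matrix :: "'n::finite set set \<Rightarrow> ('n \<Rightarrow> 'n \<Rightarrow> real) \<Rightarrow> real^'n^'n" where
  "weight_matrix E B = (\<chi> i j. if {i, j} \<in> E then B i j else 0)"

definition laplacian :: "'n::finite set set \<Rightarrow> ('n \<Rightarrow> 'n \<Rightarrow> real) \<Rightarrow> real^'n^'n" where
  "laplacian E B =
     (\<chi> i j. if i = j then (\<Sum>k\<in>UNIV. weight_matrix E B $ i $ k) else 0) - weight_matrix E B"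

definition hcat :: "'a^'k^'m \<Rightarrow> 'a^'l^'m \<Rightarrow> 'a^('k + 'l)^'m" where
  "hcat X Y = (\<chi> i j. case j of Inl k \<Rightarrow> X $ i $ k | Inr l \<Rightarrow> Y $ i $ l)"

definition vcat :: "'a^'m^'k \<Rightarrow> 'a^'m^'l \<Rightarrow> 'a^'m^('k + 'l)" where
  "vcat X Y = (\<chi> i. case i of Inl k \<Rightarrow> X $ k | Inr l \<Rightarrow> Y $ l)"

text \<open>
  Each entry of \<open>C (sI - A)\<^sup>-\<^sup>1 F\<close> is a rational function of \<open>s\<close>, given by the pointwise
  formula wherever \<open>sI - A\<close> is invertible, i.e. off the finite spectrum of \<open>A\<close>. On the
  spectrum \<open>matrix_inv\<close> is unspecified; \<open>remove_sings\<close> ignores the value there and takes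
  the limit if it exists. The value at a genuine pole is \<open>0\<close> by convention.
\<close>
definition transfer_function ::
  "real^'s^'s \<Rightarrow> real^'m^'s \<Rightarrow> real^'s^'p \<Rightarrow> complex \<Rightarrow> complex^'m^'p" where
  "transfer_function A F C s = (\<chi> i j. remove_sings
     (\<lambda>z. (map_matrix complex_of_real C ** matrix_inv (mat z - map_matrix complex_of_real A)
            ** map_matrix complex_of_real F) $ i $ j) s)"

definition conj_transpose :: "complex^'m^'p \<Rightarrow> complex^'p^'m" where
  "conj_transpose X = transpose (map_matrix cnj X)"

text \<open>Only applied to Hermitian matrices, all of whose eigenvalues are real.\<close>
definition lambda_max :: "complex^'m^'m \<Rightarrow> real" where
  "lambda_max H = Max {r. \<exists>v. v \<noteq> 0 \<and> H *v v = complex_of_real r *s v}"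

text \<open>
  The norms are extended reals, so that a finite value certifies convergence of the matrix
  integral and boundedness of the supremum. As the integrand is positive semidefinite,
  its integral converges iff that of its trace does; the trace of the integral is real.
\<close>
definition h2_norm :: "(complex \<Rightarrow> complex^'m^'p) \<Rightarrow> ereal" where
  "h2_norm G =
     (let P = (\<lambda>\<omega>::real. conj_transpose (G (\<i> * of_real \<omega>)) ** G (\<i> * of_real \<omega>))
      in if integrable lborel P
         then ereal (sqrt (1 / (2 * pi) * Re (trace (LINT \<omega>|lborel. P \<omega>)))) else \<infinity>)"

definition hinf_norm :: "(complex \<Rightarrow> complex^'m^'p) \<Rightarrow> ereal" where
  "hinf_norm G = (SUP \<omega>::real. ereal (sqrt (lambda_max
     (conj_transpose (G (\<i> * of_real \<omega>)) ** G (\<i> * of_real \<omega>)))))"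

text \<open>The state is \<open>(\<theta>, \<theta>')\<close>: \<open>Inl\<close> indexes the angles, \<open>Inr\<close> the frequencies.\<close>
definition swing_A :: "real \<Rightarrow> real \<Rightarrow> real^'n^'n \<Rightarrow> real^('n + 'n)^('n + 'n)" where
  "swing_A M D L = vcat (hcat 0 (mat 1)) (hcat (- (1 / M) *\<^sub>R L) (- (D / M) *\<^sub>R mat 1))"

definition swing_F :: "real \<Rightarrow> real^'n^('n + 'n)" where
  "swing_F M = vcat 0 ((1 / M) *\<^sub>R mat 1)"

definition freq_output :: "real^('n + 'n)^'n" where
  "freq_output = hcat 0 (mat 1)"

end

theory Submission
  imports Defs "HOL-Real_Asymp.Real_Asymp"
begin

text \<open>
  Diagonalize \<open>L = U diag(l) U\<^sup>T\<close>. On the imaginary axis the transfer function is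
  \<open>U diag(g) U\<^sup>T\<close> with the scalar modes \<open>g k = z / (M z\<^sup>2 + D z + l k)\<close>, where the removable
  singularity of the modes with \<open>l k = 0\<close> at \<open>z = 0\<close> is cancelled. Every mode, whatever \<open>l k \<ge> 0\<close> is,
  has energy \<open>\<integral> \<bar>g k\<bar>\<^sup>2 = \<pi> / (D M)\<close>, which gives the \<open>\<H>\<^sub>2\<close> norm, and gain at most \<open>1 / D\<close>. The
  gain \<open>1 / D\<close> is attained at frequency \<open>0\<close> by a mode with \<open>l k = 0\<close>, which exists because \<open>L\<close>
  annihilates the constant vectors.
\<close>

unbundle no Formal_Power_Series.fps_syntax

section \<open>Spectral theorem for real symmetric matrices\<close>

lemma quadratic_nonneg_imp_linear_coeff_zero:
  fixes b c :: real
  assumes "\<And>t. 0 \<le> b * t + c * t\<^sup>2"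
  shows "b = 0"
proof (rule ccontr)
  assume "b \<noteq> 0"
  \<comment> \<open>The minimizer of \<open>b * t + a * t^2\<close> with
    \<open>a = 1 + \<bar>c\<bar>\<close>, a positive upper bound for \<open>c\<close>.\<close>
  define t where "t = - b / (2 * (1 + \<bar>c\<bar>))"
  have "b * t + c * t\<^sup>2 \<le> b * t + (1 + \<bar>c\<bar>) * t\<^sup>2"
    by (intro add_left_mono mult_right_mono) auto
  also have "\<dots> = - (b\<^sup>2 / (4 * (1 + \<bar>c\<bar>)))"
    unfolding t_def by (simp add: divide_simps power2_eq_square) (simp add: algebra_simps)
  also have "\<dots> < 0" using \<open>b \<noteq> 0\<close> by (simp add: add_pos_nonneg)
  finally show False using assms[of t] by simp
qed

text \<open>The quadratic form \<open>f x \<bullet> x\<close> attains its maximum on the compact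
  unit sphere of \<open>S\<close>; a maximizer is an eigenvector, with the maximum as its
  eigenvalue.\<close>

lemma selfadjoint_eigenvector_exists:
  fixes f :: "'a::euclidean_space \<Rightarrow> 'a"
  assumes "linear f" and sym: "\<And>x y. f x \<bullet> y = x \<bullet> f y"
    and "subspace S" and inv: "f ` S \<subseteq> S" and "S \<noteq> {0}"
  obtains v c where "v \<in> S" "norm v = 1" "f v = c *\<^sub>R v"
proof -
  interpret linear f by fact
  obtain w where w: "w \<in> S" "w \<noteq> 0" using \<open>S \<noteq> {0}\<close> subspace_0[OF \<open>subspace S\<close>] by blast
  have "(1 / norm w) *\<^sub>R w \<in> S \<inter> sphere 0 1"
    using w subspace_mul[OF \<open>subspace S\<close>] by auto
  then have "S \<inter> sphere 0 1 \<noteq> {}" by blast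
  moreover have "compact (S \<inter> sphere 0 1)"
    using \<open>subspace S\<close> by (intro closed_Int_compact closed_subspace) auto
  moreover have "continuous_on (S \<inter> sphere 0 1) (\<lambda>x. f x \<bullet> x)"
    by (intro continuous_intros linear_continuous_on linear_conv_bounded_linear[THEN iffD1] \<open>linear f\<close>)
  ultimately obtain v where v: "v \<in> S" "norm v = 1"
    and max: "\<And>x. x \<in> S \<Longrightarrow> norm x = 1 \<Longrightarrow> f x \<bullet> x \<le> f v \<bullet> v"
    using continuous_attains_sup[of "S \<inter> sphere 0 1" "\<lambda>x. f x \<bullet> x"] by force
  define m where "m = f v \<bullet> v"
  have q: "0 \<le> m * (x \<bullet> x) - f x \<bullet> x" if "x \<in> S" for x
  proof (cases "x = 0")
    case False
    then have "f ((1 / norm x) *\<^sub>R x) \<bullet> ((1 / norm x) *\<^sub>R x) \<le> m"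
      unfolding m_def using that subspace_mul[OF \<open>subspace S\<close>] by (intro max) auto
    then show ?thesis using False by (simp add: scale field_simps dot_square_norm power2_eq_square)
  qed simp
  \<comment> \<open>The form in \<open>q\<close> is nonnegative on \<open>S\<close> and vanishes at
    \<open>v\<close>, so its first variation at \<open>v\<close> is zero in every direction
    \<open>u\<close> of \<open>S\<close>.\<close>
  have "2 * ((m *\<^sub>R v - f v) \<bullet> u) = 0" if "u \<in> S" for u
  proof (rule quadratic_nonneg_imp_linear_coeff_zero)
    fix t :: real
    have "v + t *\<^sub>R u \<in> S"
      using v that \<open>subspace S\<close> by (simp add: subspace_add subspace_mul)
    moreover have "v \<bullet> v = 1" using v(2) by (simp add: dot_square_norm)
    ultimately show "0 \<le> 2 * ((m *\<^sub>R v - f v) \<bullet> u) * t + (m * (u \<bullet> u) - f u \<bullet> u) * t\<^sup>2"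
      using q[of "v + t *\<^sub>R u"] sym[of u v] unfolding m_def
      by (simp add: add scale algebra_simps inner_simps power2_eq_square
          inner_commute[of u v] inner_commute[of u "f v"])
  qed
  \<comment> \<open>Invariance of \<open>S\<close> makes the residual itself an admissible
    direction, hence orthogonal to itself.\<close>
  moreover have "m *\<^sub>R v - f v \<in> S"
    using v inv \<open>subspace S\<close> by (auto simp: subspace_diff subspace_mul)
  ultimately have "(m *\<^sub>R v - f v) \<bullet> (m *\<^sub>R v - f v) = 0" by simp
  then have "f v = m *\<^sub>R v" by simp
  with v that show thesis by blast
qed

text \<open>Induction on dimension: split off a unit eigenvector \<open>v\<close>. By
  self-adjointness the complement of \<open>v\<close> in \<open>S\<close> is again invariant, which
  is why \<open>S\<close> ranges over invariant subspaces.\<close>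

lemma selfadjoint_orthonormal_eigenbasis:
  fixes f :: "'a::euclidean_space \<Rightarrow> 'a"
  assumes "linear f" and sym: "\<And>x y. f x \<bullet> y = x \<bullet> f y"
    and "subspace S" and "f ` S \<subseteq> S"
  shows "\<exists>B. B \<subseteq> S \<and> pairwise orthogonal B \<and> (\<forall>b\<in>B. norm b = 1 \<and> (\<exists>c. f b = c *\<^sub>R b)) \<and> span B = S"
  using assms(3,4)
proof (induction "dim S" arbitrary: S rule: less_induct)
  case less
  show ?case
  proof (cases "S = {0}")
    case True
    then show ?thesis by (intro exI[of _ "{}"]) auto
  next
    case False
    obtain v c where v: "v \<in> S" "norm v = 1" "f v = c *\<^sub>R v"
      using selfadjoint_eigenvector_exists[OF \<open>linear f\<close> sym less.prems False] by blast
    define T where "T = S \<inter> {x. v \<bullet> x = 0}"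
    have "subspace T"
      unfolding T_def using less.prems by (intro subspace_inter subspace_hyperplane)
    have "v \<notin> T" using v by (auto simp: T_def)
    then have "T \<subset> S" using v(1) unfolding T_def by blast
    then have "dim T < dim S"
      using \<open>subspace T\<close> \<open>subspace S\<close> by (metis dim_psubset span_eq_iff)
    moreover have "v \<bullet> f x = c * (v \<bullet> x)" for x
      using sym[of v x] v(3) by simp
    then have "f ` T \<subseteq> T"
      using less.prems by (auto simp: T_def)
    ultimately obtain B where B: "B \<subseteq> T" "pairwise orthogonal B"
      "\<forall>b\<in>B. norm b = 1 \<and> (\<exists>c. f b = c *\<^sub>R b)" "span B = T"
      using less.hyps \<open>subspace T\<close> by blast
    have "x \<in> span (insert v B)" if "x \<in> S" for x
    proof -
      have "x - (v \<bullet> x) *\<^sub>R v \<in> T"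
        using that v \<open>subspace S\<close> by (simp add: T_def subspace_diff subspace_mul inner_simps dot_square_norm)
      then show ?thesis using B(4) by (auto simp: span_insert)
    qed
    moreover have "span (insert v B) \<subseteq> S"
      using v B(1) \<open>T \<subset> S\<close> \<open>subspace S\<close> by (intro span_minimal) auto
    ultimately have "span (insert v B) = S" by blast
    moreover have "pairwise orthogonal (insert v B)"
      using B(1,2) by (auto simp: pairwise_insert T_def orthogonal_def inner_commute)
    ultimately show ?thesis
      using v B \<open>T \<subset> S\<close> by (intro exI[of _ "insert v B"]) auto
  qed
qed

lemma symmetric_matrix_diagonalization:
  fixes A :: "real^'n^'n"
  assumes "transpose A = A"
  obtains U :: "real^'n^'n" and l :: "'n \<Rightarrow> real"
  where "orthogonal_matrix U" "\<And>k. A *v column k U = l k *\<^sub>R column k U"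
proof -
  have "(A *v x) \<bullet> y = x \<bullet> (A *v y)" for x y
    by (metis assms dot_lmul_matrix transpose_matrix_vector)
  then obtain B where B: "pairwise orthogonal B"
    "\<forall>b\<in>B. norm b = 1 \<and> (\<exists>c. A *v b = c *\<^sub>R b)" "span B = (UNIV :: (real^'n) set)"
    using selfadjoint_orthonormal_eigenbasis[of "(*v) A" UNIV] by auto
  \<comment> \<open>A spanning orthonormal set has exactly \<open>CARD('n)\<close> elements, so
    \<open>'n\<close> can index it and its vectors can serve as the columns of
    \<open>U\<close>.\<close>
  have "independent B" using B by (intro pairwise_orthogonal_independent) auto
  then have "finite B" "card B = CARD('n)"
    using B(3) by (auto simp: independent_imp_finite dest: dim_eq_card_independent
        simp flip: dim_span[of B])
  then obtain b :: "'n \<Rightarrow> real^'n" where b: "bij_betw b UNIV B"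
    by (metis bij_betw_iff_card finite_class.finite_UNIV)
  define U where "U = (\<chi> i j. b j $ i)"
  have col: "column k U = b k" for k by (simp add: column_def U_def)
  have "orthogonal_matrix U"
    unfolding orthogonal_matrix_orthonormal_columns col
    using B(1,2) b by (metis UNIV_I bij_betw_apply bij_betw_def inj_onD pairwiseD)
  moreover have "\<exists>c. A *v b k = c *\<^sub>R b k" for k
    using B(2) bij_betw_apply[OF b, of k] by blast
  then obtain l where "A *v b k = l k *\<^sub>R b k" for k by metis
  ultimately show thesis by (intro that[of U l]) (simp_all add: col)
qed

section \<open>Block matrices and matrix inverses\<close>

lemma hcat_mult_vcat: "hcat A B ** vcat X Y = A ** X + B ** Y"
  by (simp add: vec_eq_iff matrix_matrix_mult_def hcat_def vcat_def sum.Plus flip: UNIV_Plus_UNIV)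

lemma vcat_mult: "vcat A B ** X = vcat (A ** X) (B ** X)"
  by (simp add: vec_eq_iff matrix_matrix_mult_def vcat_def split: sum.splits)

lemma mult_hcat: "X ** hcat A B = hcat (X ** A) (X ** B)"
  by (simp add: vec_eq_iff matrix_matrix_mult_def hcat_def split: sum.splits)

lemma hcat_add: "hcat A B + hcat X Y = hcat (A + X) (B + Y)"
  by (simp add: vec_eq_iff hcat_def split: sum.splits)

lemma mat_sum_index: "mat c = vcat (hcat (mat c) 0) (hcat 0 (mat c))"
  by (auto simp: vec_eq_iff mat_def hcat_def vcat_def split: sum.splits)

lemma matrix_inv_eqI:
  fixes A :: "'a::field^'n^'n"
  assumes "A ** B = mat 1"
  shows "matrix_inv A = B"
proof -
  have BA: "B ** A = mat 1" using assms matrix_left_right_inverse by blast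
  have "A ** matrix_inv A = mat 1 \<and> matrix_inv A ** A = mat 1"
    unfolding matrix_inv_def using assms BA
    by (simp add: someI[of "\<lambda>X. A ** X = mat 1 \<and> X ** A = mat 1" B])
  then have "B ** (A ** matrix_inv A) = B" by simp
  then show ?thesis by (simp add: matrix_mul_assoc BA)
qed

section \<open>Functional calculus in a fixed orthonormal basis\<close>

definition diag_mat :: "('n \<Rightarrow> 'a::zero) \<Rightarrow> 'a^'n^'n" where
  "diag_mat d = (\<chi> i j. if i = j then d i else 0)"

lemma mult_diag_mat_entry: "(A ** diag_mat d) $ i $ k = A $ i $ k * d k"
  for d :: "'n::finite \<Rightarrow> 'a::semiring_1"
  by (simp add: diag_mat_def matrix_matrix_mult_def if_distrib cong: if_cong)

lemma diag_mat_mult: "diag_mat d ** diag_mat e = diag_mat (\<lambda>k. d k * e k)"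
  for d :: "'n::finite \<Rightarrow> 'a::semiring_1"
  by (simp add: vec_eq_iff mult_diag_mat_entry) (simp add: diag_mat_def)

lemma diag_mat_mult_vec_entry: "(diag_mat d *v x) $ k = d k * x $ k"
  for d :: "'n::finite \<Rightarrow> 'a::semiring_1"
  by (simp add: diag_mat_def matrix_vector_mult_def if_distrib if_distribR cong: if_cong)

lemma map_matrix_of_real_mult:
  "map_matrix complex_of_real (A ** B) = map_matrix complex_of_real A ** map_matrix complex_of_real B"
  by (simp add: vec_eq_iff matrix_matrix_mult_def)

text \<open>For orthogonal \<open>U\<close> this is an algebra homomorphism in \<open>d\<close>, so
  matrix identities reduce to scalar identities for each mode. The plain transpose suffices because
  \<open>U\<close> is real.\<close>

definition spectral_matrix :: "real^'n^'n \<Rightarrow> ('n \<Rightarrow> complex) \<Rightarrow> complex^'n^'n" where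
  "spectral_matrix U d =
     map_matrix complex_of_real U ** diag_mat d ** transpose (map_matrix complex_of_real U)"

lemma spectral_matrix_entry:
  "spectral_matrix U d $ i $ j = (\<Sum>k\<in>UNIV. complex_of_real (U $ i $ k) * d k * complex_of_real (U $ j $ k))"
  unfolding spectral_matrix_def
  by (subst matrix_matrix_mult_def) (simp add: mult_diag_mat_entry transpose_def)

lemma spectral_matrix_add:
  "spectral_matrix U d + spectral_matrix U e = spectral_matrix U (\<lambda>k. d k + e k)"
  by (simp add: vec_eq_iff spectral_matrix_entry algebra_simps flip: sum.distrib)

lemma conj_transpose_spectral_matrix:
  "conj_transpose (spectral_matrix U d) = spectral_matrix U (\<lambda>k. cnj (d k))"
  by (simp add: vec_eq_iff conj_transpose_def transpose_def spectral_matrix_entry mult_ac)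

context
  fixes U :: "real^'n^'n"
  assumes U: "orthogonal_matrix U"
begin

lemma complexified_orthogonal_matrix:
  "transpose (map_matrix complex_of_real U) ** map_matrix complex_of_real U = mat 1"
  "map_matrix complex_of_real U ** transpose (map_matrix complex_of_real U) = mat 1"
proof -
  have *: "transpose (map_matrix complex_of_real U) = map_matrix complex_of_real (transpose U)"
    "map_matrix complex_of_real (mat 1) = (mat 1 :: complex^'n^'n)"
    by (simp_all add: vec_eq_iff transpose_def mat_def)
  show "transpose (map_matrix complex_of_real U) ** map_matrix complex_of_real U = mat 1"
    "map_matrix complex_of_real U ** transpose (map_matrix complex_of_real U) = mat 1"
    using U unfolding orthogonal_matrix_def
    by (simp_all add: * flip: map_matrix_of_real_mult)
qed

lemma spectral_matrix_mult:
  "spectral_matrix U d ** spectral_matrix U e = spectral_matrix U (\<lambda>k. d k * e k)"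
proof -
  let ?V = "map_matrix complex_of_real U"
  have "spectral_matrix U d ** spectral_matrix U e =
      ?V ** diag_mat d ** (transpose ?V ** ?V) ** diag_mat e ** transpose ?V"
    by (simp only: spectral_matrix_def matrix_mul_assoc)
  also have "\<dots> = ?V ** (diag_mat d ** diag_mat e) ** transpose ?V"
    by (simp add: complexified_orthogonal_matrix matrix_mul_assoc)
  finally show ?thesis by (simp add: spectral_matrix_def diag_mat_mult)
qed

lemma spectral_matrix_const: "spectral_matrix U (\<lambda>_. c) = mat c"
proof -
  have "spectral_matrix U (\<lambda>_. c) $ i $ j = c * mat 1 $ i $ j" for i j
    unfolding complexified_orthogonal_matrix(2)[symmetric]
    by (simp add: spectral_matrix_entry matrix_matrix_mult_def transpose_def sum_distrib_left mult_ac)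
  then show ?thesis by (simp add: vec_eq_iff mat_def)
qed

text \<open>In the coordinates \<open>y = transpose ?V *v v\<close> the eigenvalue equation is
  diagonal: a nonzero entry \<open>y $ k\<close> forces \<open>c k = r\<close>. Conversely, column
  \<open>k\<close> of \<open>U\<close> is an eigenvector for \<open>c k\<close>.\<close>

lemma spectral_matrix_real_eigenvalues:
  "{r. \<exists>v. v \<noteq> 0 \<and> spectral_matrix U (\<lambda>k. complex_of_real (c k)) *v v = complex_of_real r *s v} = range c"
proof (intro equalityI subsetI)
  let ?V = "map_matrix complex_of_real U" and ?D = "diag_mat (\<lambda>k. complex_of_real (c k))"
  {
    fix r assume "r \<in> {r. \<exists>v. v \<noteq> 0 \<and> spectral_matrix U (\<lambda>k. complex_of_real (c k)) *v v = complex_of_real r *s v}"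
    then obtain v where v: "v \<noteq> 0" "spectral_matrix U (\<lambda>k. complex_of_real (c k)) *v v = complex_of_real r *s v"
      by blast
    define y where "y = transpose ?V *v v"
    have "?V *v y = v"
      unfolding y_def by (simp only: matrix_vector_mul_assoc complexified_orthogonal_matrix matrix_vector_mul_lid)
    with v(1) obtain k where "y $ k \<noteq> 0"
      by (metis matrix_vector_mult_0_right vec_eq_iff zero_index)
    have "?D *v y = transpose ?V *v (spectral_matrix U (\<lambda>k. complex_of_real (c k)) *v v)"
      unfolding y_def spectral_matrix_def
      by (simp only: matrix_vector_mul_assoc matrix_mul_assoc complexified_orthogonal_matrix matrix_mul_lid)
    also have "\<dots> = complex_of_real r *s y"
      unfolding v(2) y_def by (rule vector_scalar_commute)
    finally have "(?D *v y) $ k = (complex_of_real r *s y) $ k" by simp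
    with \<open>y $ k \<noteq> 0\<close> have "c k = r" by (simp add: diag_mat_mult_vec_entry)
    then show "r \<in> range c" by blast
  }
  fix r assume "r \<in> range c"
  then obtain k where k: "r = c k" by blast
  define v where "v = ?V *v axis k 1"
  have Vv: "transpose ?V *v v = axis k 1"
    unfolding v_def by (simp only: matrix_vector_mul_assoc complexified_orthogonal_matrix matrix_vector_mul_lid)
  have "spectral_matrix U (\<lambda>k. complex_of_real (c k)) *v v = ?V *v (?D *v (transpose ?V *v v))"
    unfolding spectral_matrix_def by (simp only: matrix_vector_mul_assoc matrix_mul_assoc)
  also have "?D *v (transpose ?V *v v) = complex_of_real r *s axis k 1"
    unfolding Vv by (simp add: vec_eq_iff diag_mat_mult_vec_entry axis_def k)
  also have "?V *v (complex_of_real r *s axis k 1) = complex_of_real r *s v"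
    unfolding v_def by (rule vector_scalar_commute)
  finally have eig: "spectral_matrix U (\<lambda>k. complex_of_real (c k)) *v v = complex_of_real r *s v" .
  have "v \<noteq> 0" using Vv by (metis axis_eq_0_iff matrix_vector_mult_0_right one_neq_zero)
  with eig show "r \<in> {r. \<exists>v. v \<noteq> 0 \<and> spectral_matrix U (\<lambda>k. complex_of_real (c k)) *v v = complex_of_real r *s v}"
    by blast
qed

lemma lambda_max_spectral_matrix:
  "lambda_max (spectral_matrix U (\<lambda>k. complex_of_real (c k))) = Max (range c)"
  by (simp add: lambda_max_def spectral_matrix_real_eigenvalues)

text \<open>All blocks are diagonal in the same basis, so \<open>zI - A\<close> decouples into the
  scalar 2x2 matrices with rows \<open>(z, -1)\<close> and \<open>(l k / M, z + D / M)\<close>,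
  which are inverted mode by mode.\<close>

lemma swing_transfer_matrix:
  fixes M D :: real and L :: "real^'n^'n" and l :: "'n \<Rightarrow> real" and z :: complex
  assumes "M \<noteq> 0"
    and L: "map_matrix complex_of_real L = spectral_matrix U (\<lambda>k. complex_of_real (l k))"
    and nz: "\<And>k. M * z\<^sup>2 + D * z + l k \<noteq> 0"
  shows "map_matrix complex_of_real freq_output
      ** matrix_inv (mat z - map_matrix complex_of_real (swing_A M D L))
      ** map_matrix complex_of_real (swing_F M)
    = spectral_matrix U (\<lambda>k. z / (M * z\<^sup>2 + D * z + l k))"
proof -
  let ?S = "spectral_matrix U"
  \<comment> \<open>The reciprocal determinant of the 2x2 matrix of mode \<open>k\<close>.\<close>
  define q where "q k = M / (M * z\<^sup>2 + D * z + l k)" for k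
  have q: "z * (z + D / M) * q k + l k / M * q k = 1" for k
  proof -
    have "(z * (z + D / M) + l k / M) * M = M * z\<^sup>2 + D * z + l k"
      using assms(1) by (simp add: field_simps power2_eq_square)
    then show ?thesis using nz[of k] unfolding q_def
      by (simp add: add_divide_distrib[symmetric] ring_distribs(2)[symmetric] mult.assoc[symmetric] distrib_right)
  qed
  have A: "mat z - map_matrix complex_of_real (swing_A M D L) =
      vcat (hcat (?S (\<lambda>_. z)) (?S (\<lambda>_. -1))) (hcat (?S (\<lambda>k. l k / M)) (?S (\<lambda>_. z + D / M)))"
  proof -
    have "complex_of_real (L $ i $ j) = ?S (\<lambda>k. complex_of_real (l k)) $ i $ j" for i j
      by (metis L nth_map_matrix)
    then have "?S (\<lambda>k. l k / M) $ i $ j = complex_of_real (L $ i $ j / M)" for i j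
      by (simp add: spectral_matrix_entry sum_divide_distrib)
    then show ?thesis
      unfolding spectral_matrix_const
      by (auto simp: vec_eq_iff swing_A_def vcat_def hcat_def mat_def split: sum.splits)
  qed
  have F: "map_matrix complex_of_real (swing_F M) = vcat (?S (\<lambda>_. 0)) (?S (\<lambda>_. 1 / M))"
    unfolding spectral_matrix_const
    by (auto simp: vec_eq_iff swing_F_def vcat_def mat_def split: sum.splits)
  have C: "map_matrix complex_of_real freq_output = hcat (?S (\<lambda>_. 0)) (?S (\<lambda>_. 1))"
    unfolding spectral_matrix_const
    by (auto simp: vec_eq_iff freq_output_def hcat_def mat_def split: sum.splits)
  have one: "(mat 1 :: complex^('n + 'n)^('n + 'n)) =
      vcat (hcat (?S (\<lambda>_. 1)) (?S (\<lambda>_. 0))) (hcat (?S (\<lambda>_. 0)) (?S (\<lambda>_. 1)))"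
    by (subst mat_sum_index) (simp add: spectral_matrix_const)
  \<comment> \<open>In each mode, the adjugate times the reciprocal determinant.\<close>
  define Y where "Y = vcat (hcat (?S (\<lambda>k. (z + D / M) * q k)) (?S q))
      (hcat (?S (\<lambda>k. - (l k / M * q k))) (?S (\<lambda>k. z * q k)))"
  have inv: "matrix_inv (mat z - map_matrix complex_of_real (swing_A M D L)) = Y"
  proof (rule matrix_inv_eqI)
    have "z * ((z + D / M) * q k) + l k / M * q k = 1"
      "l k / M * q k + (z + D / M) * (z * q k) = 1" for k
      using q[of k] by (simp_all add: algebra_simps)
    moreover have "l k / M * ((z + D / M) * q k) = (z + D / M) * (l k / M * q k)" for k
      by (rule mult.left_commute)
    ultimately show "(mat z - map_matrix complex_of_real (swing_A M D L)) ** Y = mat 1"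
      unfolding A Y_def one vcat_mult hcat_mult_vcat mult_hcat hcat_add spectral_matrix_mult spectral_matrix_add
      by simp
  qed
  \<comment> \<open>Input and output select the lower right block \<open>z * q k\<close>, scaled by
    \<open>1 / M\<close>.\<close>
  show ?thesis
    unfolding inv C F Y_def hcat_mult_vcat mult_hcat hcat_add spectral_matrix_mult spectral_matrix_add
    using assms(1) by (simp add: q_def)
qed

end

section \<open>Graph Laplacians\<close>

lemma laplacian_mult_vec:
  "(laplacian E B *v x) $ i = (\<Sum>j\<in>UNIV. weight_matrix E B $ i $ j * (x $ i - x $ j))"
  by (simp add: laplacian_def matrix_vector_mult_def left_diff_distrib right_diff_distrib sum_subtractf
      if_distrib[where f = "\<lambda>a. a * b" for b] sum_distrib_right cong: if_cong)

lemma weight_matrix_sym_nonneg: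
  assumes "weighted_graph E B"
  shows "weight_matrix E B $ i $ j = weight_matrix E B $ j $ i" "0 \<le> weight_matrix E B $ i $ j"
  using assms by (auto simp: weighted_graph_def weight_matrix_def insert_commute less_imp_le)

lemma transpose_laplacian:
  assumes "weighted_graph E B"
  shows "transpose (laplacian E B) = laplacian E B"
  using weight_matrix_sym_nonneg(1)[OF assms]
  by (auto simp: vec_eq_iff transpose_def laplacian_def)

text \<open>Adding the quadratic form to its copy with the summation indices swapped gives a
  weighted sum of the squares \<open>(x $ i - x $ j)^2\<close>.\<close>

lemma laplacian_psd:
  assumes "weighted_graph E B"
  shows "0 \<le> x \<bullet> (laplacian E B *v x)"
proof -
  let ?W = "\<lambda>i j. weight_matrix E B $ i $ j"
  have 1: "x \<bullet> (laplacian E B *v x) = (\<Sum>i\<in>UNIV. \<Sum>j\<in>UNIV. ?W i j * (x $ i * (x $ i - x $ j)))"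
    by (simp add: inner_vec_def laplacian_mult_vec sum_distrib_left mult_ac)
  have 2: "x \<bullet> (laplacian E B *v x) = (\<Sum>i\<in>UNIV. \<Sum>j\<in>UNIV. ?W i j * (x $ j * (x $ j - x $ i)))"
    unfolding 1 by (subst sum.swap) (simp add: weight_matrix_sym_nonneg(1)[OF assms])
  have "2 * (x \<bullet> (laplacian E B *v x)) = (\<Sum>i\<in>UNIV. \<Sum>j\<in>UNIV.
      ?W i j * (x $ i * (x $ i - x $ j)) + ?W i j * (x $ j * (x $ j - x $ i)))"
    unfolding sum.distrib using 1 2 by linarith
  also have "\<dots> = (\<Sum>i\<in>UNIV. \<Sum>j\<in>UNIV. ?W i j * (x $ i - x $ j)\<^sup>2)"
    by (simp add: power2_eq_square algebra_simps)
  finally have "2 * (x \<bullet> (laplacian E B *v x)) = (\<Sum>i\<in>UNIV. \<Sum>j\<in>UNIV. ?W i j * (x $ i - x $ j)\<^sup>2)" .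
  moreover have "0 \<le> (\<Sum>i\<in>UNIV. \<Sum>j\<in>UNIV. ?W i j * (x $ i - x $ j)\<^sup>2)"
    by (intro sum_nonneg mult_nonneg_nonneg weight_matrix_sym_nonneg[OF assms]) auto
  ultimately show ?thesis by linarith
qed

section \<open>Energy integrals over the real line\<close>

lemma has_bochner_integral_inverse_square_plus_square:
  fixes D :: real
  assumes "D > 0"
  shows "has_bochner_integral lborel (\<lambda>t. 1 / (D\<^sup>2 + t\<^sup>2)) (pi / D)"
proof -
  let ?f = "\<lambda>t. 1 / (D\<^sup>2 + t\<^sup>2)" and ?F = "\<lambda>t. arctan (t / D) / D"
  have pos: "D\<^sup>2 + t\<^sup>2 > 0" for t using assms by (simp add: add_pos_nonneg)
  have deriv: "DERIV ?F t :> ?f t" for t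
  proof -
    have "D\<^sup>2 + t\<^sup>2 = D * D * (1 + (t / D)\<^sup>2)"
      using assms by (simp add: field_simps power2_eq_square)
    then have "?f t = inverse (1 + (t / D)\<^sup>2) * (1 / D) / D"
      by (simp add: divide_inverse)
    then show ?thesis using assms by (auto intro!: derivative_eq_intros)
  qed
  have cont: "isCont ?f t" for t
    using pos[of t] by (intro continuous_intros) auto
  have "(?F \<longlongrightarrow> - (pi / 2) / D) at_bot" "(?F \<longlongrightarrow> pi / 2 / D) at_top"
    using assms by (real_asymp; simp add: field_simps)+
  then have lim: "((?F \<circ> real_of_ereal) \<longlongrightarrow> - (pi / 2) / D) (at_right (-\<infinity>))"
    "((?F \<circ> real_of_ereal) \<longlongrightarrow> pi / 2 / D) (at_left \<infinity>)"
    by (simp_all add: ereal_tendsto_simps)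
  \<comment> \<open>For a nonnegative integrand the fundamental theorem yields integrability along
    with the value, from the limits of the antiderivative.\<close>
  note ftc = interval_integral_FTC_nonneg[OF _ deriv cont _ lim]
  have "set_integrable lborel (einterval (-\<infinity>) \<infinity>) ?f" using pos by (intro ftc) (auto simp: less_imp_le)
  moreover have "(LBINT t=-\<infinity>..\<infinity>. ?f t) = pi / 2 / D - - (pi / 2) / D"
    using pos by (intro ftc) (auto simp: less_imp_le)
  ultimately show ?thesis
    by (simp add: has_bochner_integral_iff set_integrable_def interval_lebesgue_integral_def
        set_lebesgue_integral_def)
qed

text \<open>The substitution \<open>t = M \<omega> - l / \<omega>\<close> maps \<open>(0, \<infinity>)\<close> onto the real line; after it, the Jacobian
  of the inverse is a constant plus an odd function of \<open>t\<close>.\<close>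
lemma has_bochner_integral_resonance:
  fixes M D l :: real
  assumes "M > 0" "D > 0" "l > 0"
  shows "has_bochner_integral lborel (\<lambda>w. w\<^sup>2 / ((l - M * w\<^sup>2)\<^sup>2 + D\<^sup>2 * w\<^sup>2)) (pi / (D * M))"
proof -
  let ?f = "\<lambda>w. w\<^sup>2 / ((l - M * w\<^sup>2)\<^sup>2 + D\<^sup>2 * w\<^sup>2)"
  \<comment> \<open>\<open>g t\<close> is the positive root \<open>w\<close> of
    \<open>M * w^2 - t * w - l = 0\<close>, that is, the inverse of the substitution;
    \<open>g'\<close> is its derivative.\<close>
  define r where "r t = sqrt (t\<^sup>2 + 4 * M * l)" for t
  define g where "g t = (t + r t) / (2 * M)" for t
  define g' where "g' t = (1 + t / r t) / (2 * M)" for t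
  define h where "h t = 1 / (D\<^sup>2 + t\<^sup>2)" for t
  have c: "0 < 4 * M * l" using assms by simp
  have rpos: "\<bar>t\<bar> < r t" "0 < r t" for t
  proof -
    have "sqrt (t\<^sup>2) < r t" unfolding r_def using c by (intro real_sqrt_less_mono) simp
    then show "\<bar>t\<bar> < r t" by simp
    then show "0 < r t" by linarith
  qed
  have gpos: "g t > 0" for t using rpos(1)[of t] assms by (simp add: g_def)
  have "(r t)\<^sup>2 = t\<^sup>2 + 4 * M * l" for t using c by (simp add: r_def)
  then have root: "M * (g t)\<^sup>2 - l = t * g t" for t
    using assms by (simp add: g_def field_simps power2_eq_square)
  \<comment> \<open>At \<open>w = g t\<close> the term \<open>l - M * w^2\<close> equals
    \<open>- t * w\<close>, so \<open>w^2\<close> cancels from the fraction.\<close>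
  have fg: "?f (g t) = h t" for t
  proof -
    have "(l - M * (g t)\<^sup>2)\<^sup>2 = t\<^sup>2 * (g t)\<^sup>2"
      by (metis power2_commute root power_mult_distrib)
    then have "?f (g t) = (g t)\<^sup>2 / ((D\<^sup>2 + t\<^sup>2) * (g t)\<^sup>2)"
      by (simp add: algebra_simps)
    then show ?thesis using gpos[of t] by (simp add: h_def)
  qed
  have drv: "DERIV g t :> g' t" for t
  proof -
    have "t\<^sup>2 + 4 * M * l > 0" using c by (simp add: add_nonneg_pos)
    then show ?thesis unfolding g_def [abs_def] g'_def r_def [abs_def] using assms
      by (auto intro!: derivative_eq_intros simp: divide_simps)
  qed
  have contg': "isCont g' t" for t
    unfolding g'_def [abs_def] r_def [abs_def] using rpos(2)[of t] assms 
    by (intro continuous_intros) (auto simp: r_def)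
  have g'_nonneg: "0 \<le> g' t" for t
    using rpos[of t] assms by (auto simp: g'_def field_simps)
  have den: "(l - M * w\<^sup>2)\<^sup>2 + D\<^sup>2 * w\<^sup>2 > 0" for w
    using assms by (cases "w = 0") (auto simp: add_nonneg_pos)
  \<comment> \<open>These limits give the endpoints \<open>0\<close> and \<open>\<infinity>\<close>
    of the substituted integral.\<close>
  have lim: "(g \<longlongrightarrow> 0) at_bot" "filterlim g at_top at_top"
    unfolding g_def [abs_def] r_def [abs_def] using assms c by real_asymp+
  have hint: "has_bochner_integral lborel h (pi / D)"
    unfolding h_def using has_bochner_integral_inverse_square_plus_square[OF assms(2)] by simp
  have oddb: "\<bar>h t * (t / r t)\<bar> \<le> \<bar>h t\<bar>" for t
  proof -
    have "\<bar>t / r t\<bar> \<le> 1" using rpos[of t] by (simp add: abs_div_pos[symmetric] less_imp_le)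
    then show ?thesis unfolding abs_mult using mult_left_mono[of "\<bar>t / r t\<bar>" 1 "\<bar>h t\<bar>"] by simp
  qed
  have oddi: "integrable lborel (\<lambda>t. h t * (t / r t))"
    by (rule Bochner_Integration.integrable_bound[of lborel h])
      (use hint oddb in \<open>auto simp: h_def r_def has_bochner_integral_iff\<close>)
  \<comment> \<open>Reflecting \<open>t\<close> to \<open>- t\<close> shows that the integral of the
    odd part equals its own negative, hence is zero.\<close>
  have "(\<integral>t. h t * (t / r t) \<partial>lborel) = (\<integral>t. - (h t * (t / r t)) \<partial>lborel)"
    by (subst lborel_integral_real_affine[of "-1" _ 0]) (simp_all add: h_def r_def)
  then have "has_bochner_integral lborel (\<lambda>t. h t * (t / r t)) 0"
    using oddi by (simp add: has_bochner_integral_iff)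
  from has_bochner_integral_divide_zero[OF has_bochner_integral_add[OF hint this], of "2 * M"]
  have fgint: "has_bochner_integral lborel (\<lambda>t. ?f (g t) * g' t) (pi / D / (2 * M))"
    unfolding fg g'_def by (simp add: algebra_simps add_divide_distrib)
  note sub = interval_integral_substitution_nonneg[of "-\<infinity>" "\<infinity>" g g' ?f 0 "\<infinity>"]
  have prem: "((ereal \<circ> g \<circ> real_of_ereal) \<longlongrightarrow> 0) (at_right (-\<infinity>))"
    "((ereal \<circ> g \<circ> real_of_ereal) \<longlongrightarrow> \<infinity>) (at_left \<infinity>)"
    using lim by (simp_all add: ereal_tendsto_simps zero_ereal_def)
  have intfg: "set_integrable lborel (einterval (-\<infinity>) \<infinity>) (\<lambda>t. ?f (g t) * g' t)"
    using fgint by (simp add: set_integrable_def has_bochner_integral_iff)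
  have contf: "isCont ?f w" for w
    using den[of w] by (intro continuous_intros) auto
  have fnn: "0 \<le> ?f w" for w using den[of w] by simp
  have "set_integrable lborel (einterval 0 \<infinity>) ?f"
    "(LBINT w=0..\<infinity>. ?f w) = (LBINT t=-\<infinity>..\<infinity>. ?f (g t) * g' t)"
    by (rule sub; (rule drv contf contg' fnn g'_nonneg prem intfg | simp))+
  then have "has_bochner_integral lborel (\<lambda>w. indicator {0<..} w *\<^sub>R ?f w) (pi / D / (2 * M))"
    using fgint
    by (simp add: has_bochner_integral_iff interval_lebesgue_integral_def set_lebesgue_integral_def
        set_integrable_def zero_ereal_def einterval_eq_Ici)
  \<comment> \<open>Adding the endpoint is harmless since the integrand vanishes at
    \<open>0\<close>; evenness then doubles the half-line integral.\<close>
  then have "has_bochner_integral lborel (\<lambda>w. indicator {0..} w *\<^sub>R ?f w) (pi / D / (2 * M))"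
    by (rule has_bochner_integral_cong[THEN iffD1, rotated -1]) (auto simp: indicator_def)
  from has_bochner_integral_even_function[OF this] show ?thesis by (simp add: algebra_simps)
qed

section \<open>Scalar modes on the imaginary axis\<close>

text \<open>For \<open>l = 0\<close> the common factor \<open>z\<close> is divided out, so the value
  at \<open>z = 0\<close> is \<open>1 / D\<close> instead of the default
  \<open>0 / 0 = 0\<close>.\<close>

definition swing_mode :: "real \<Rightarrow> real \<Rightarrow> real \<Rightarrow> complex \<Rightarrow> complex" where
  "swing_mode M D l z = (if l = 0 then 1 / (M * z + D) else z / (M * z\<^sup>2 + D * z + l))"

lemma swing_mode_eq:
  assumes "z \<noteq> 0"
  shows "swing_mode M D l z = z / (M * z\<^sup>2 + D * z + l)"
proof (cases "l = 0")
  case True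
  have "M * z\<^sup>2 + D * z + l = z * (M * z + D)"
    using True by (simp add: power2_eq_square algebra_simps)
  then show ?thesis using assms True by (simp add: swing_mode_def)
qed (simp add: swing_mode_def)

text \<open>Damping keeps the poles off the axis. For \<open>l = 0\<close> the denominator has real
  part \<open>D\<close>; otherwise its imaginary part \<open>D * w\<close> vanishes only at
  \<open>w = 0\<close>, where the real part is \<open>l\<close>.\<close>

lemma swing_mode_isCont:
  assumes "M > 0" "D > 0"
  shows "isCont (swing_mode M D l) (\<i> * complex_of_real w)"
proof (cases "l = 0")
  case True
  have "M * (\<i> * complex_of_real w) + D \<noteq> 0"
    using assms by (auto simp: complex_eq_iff)
  then show ?thesis
    using True unfolding swing_mode_def [abs_def] by (auto intro!: continuous_intros)
next
  case False
  have "M * (\<i> * complex_of_real w)\<^sup>2 + D * (\<i> * complex_of_real w) + l \<noteq> 0"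
    using assms False by (auto simp: complex_eq_iff power2_eq_square)
  then show ?thesis
    using False unfolding swing_mode_def [abs_def] by (auto intro!: continuous_intros)
qed

lemma norm_swing_mode:
  "(norm (swing_mode M D l (\<i> * complex_of_real w)))\<^sup>2 =
    (if l = 0 then 1 / (D\<^sup>2 + (M * w)\<^sup>2) else w\<^sup>2 / ((l - M * w\<^sup>2)\<^sup>2 + D\<^sup>2 * w\<^sup>2))"
proof -
  have "(norm (M * (\<i> * complex_of_real w) + D))\<^sup>2 = D\<^sup>2 + (M * w)\<^sup>2"
    by (simp add: cmod_power2)
  moreover have "(norm (M * (\<i> * complex_of_real w)\<^sup>2 + D * (\<i> * complex_of_real w) + l))\<^sup>2
      = (l - M * w\<^sup>2)\<^sup>2 + D\<^sup>2 * w\<^sup>2"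
    by (simp add: cmod_power2 power_mult_distrib)
  ultimately show ?thesis
    by (simp add: swing_mode_def norm_divide power_divide norm_mult)
qed

text \<open>The energy does not depend on \<open>l\<close>: for \<open>l = 0\<close>, rescaling the
  arctangent integral by \<open>M\<close> gives the same value as the resonance integral.\<close>

lemma has_bochner_integral_swing_mode:
  assumes "M > 0" "D > 0" "l \<ge> 0"
  shows "has_bochner_integral lborel
    (\<lambda>w. (norm (swing_mode M D l (\<i> * complex_of_real w)))\<^sup>2) (pi / (D * M))"
proof (cases "l = 0")
  case True
  have "has_bochner_integral lborel (\<lambda>w. 1 / (D\<^sup>2 + (0 + M * w)\<^sup>2)) ((pi / D) /\<^sub>R \<bar>M\<bar>)"
    using has_bochner_integral_inverse_square_plus_square[OF assms(2)] assms(1)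
    by (subst (asm) lborel_has_bochner_integral_real_affine_iff[of M _ _ 0]) auto
  then show ?thesis
    unfolding norm_swing_mode using True assms by (simp add: field_simps)
next
  case False
  then show ?thesis
    unfolding norm_swing_mode using has_bochner_integral_resonance[of M D l] assms by simp
qed

text \<open>Dropping the square \<open>(M * w)^2\<close> or \<open>(l - M * w^2)^2\<close> from the
  denominator leaves only the damping term.\<close>

lemma norm_swing_mode_le:
  assumes "D > 0"
  shows "(norm (swing_mode M D l (\<i> * complex_of_real w)))\<^sup>2 \<le> (1 / D)\<^sup>2"
proof -
  have "1 / (D\<^sup>2 + (M * w)\<^sup>2) \<le> 1 / D\<^sup>2"
    using assms by (intro divide_left_mono) (auto intro!: mult_pos_pos add_pos_nonneg)
  moreover have "w\<^sup>2 / ((l - M * w\<^sup>2)\<^sup>2 + D\<^sup>2 * w\<^sup>2) \<le> 1 / D\<^sup>2"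
  \<comment> \<open>At \<open>w = 0\<close> the remaining denominator \<open>D^2 * w^2\<close> would
    vanish, but there the quotient itself is \<open>0\<close>.\<close>
  proof (cases "w = 0")
    case False
    then have "w\<^sup>2 / ((l - M * w\<^sup>2)\<^sup>2 + D\<^sup>2 * w\<^sup>2) \<le> w\<^sup>2 / (D\<^sup>2 * w\<^sup>2)"
      using assms by (intro divide_left_mono) (auto intro!: mult_pos_pos add_nonneg_pos)
    then show ?thesis using False by simp
  qed simp
  ultimately show ?thesis unfolding norm_swing_mode by (simp add: power_divide)
qed

section \<open>Transfer function with removable singularities filled in\<close>

lemma eventually_quadratic_nonzero:
  fixes a b c s :: complex
  assumes "a \<noteq> 0"
  shows "\<forall>\<^sub>F z in at s. a * z\<^sup>2 + b * z + c \<noteq> 0"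
proof -
  have "finite {z. poly [:c, b, a:] z = 0}"
    using assms by (intro poly_roots_finite) simp
  then have "\<forall>\<^sub>F z in at s. z \<notin> {z. poly [:c, b, a:] z = 0}"
    using islimpt_finite islimpt_iff_eventually by blast
  then show ?thesis
    by eventually_elim (simp add: algebra_simps power2_eq_square)
qed

text \<open>The resolvent formula holds on a punctured neighbourhood of the point, even if the point
  is an eigenvalue of the system matrix. Since the modes are continuous there,
  \<open>remove_sings\<close> returns their value.\<close>

lemma swing_transfer_function:
  fixes U L :: "real^'n^'n"
  assumes "M > 0" "D > 0" "orthogonal_matrix U"
    and L: "map_matrix complex_of_real L = spectral_matrix U (\<lambda>k. complex_of_real (l k))"
  shows "transfer_function (swing_A M D L) (swing_F M) freq_output (\<i> * complex_of_real w) =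
    spectral_matrix U (\<lambda>k. swing_mode M D (l k) (\<i> * complex_of_real w))"
proof -
  let ?s = "\<i> * complex_of_real w"
  let ?R = "\<lambda>z. map_matrix complex_of_real freq_output
      ** matrix_inv (mat z - map_matrix complex_of_real (swing_A M D L))
      ** map_matrix complex_of_real (swing_F M)"
  have "remove_sings (\<lambda>z. ?R z $ i $ j) ?s = spectral_matrix U (\<lambda>k. swing_mode M D (l k) ?s) $ i $ j" for i j
  proof (rule remove_sings_eqI)
    have "\<forall>\<^sub>F z in at ?s. \<forall>k\<in>UNIV. M * z\<^sup>2 + D * z + l k \<noteq> 0"
      using assms(1) by (intro eventually_ball_finite ballI eventually_quadratic_nonzero) auto
    \<comment> \<open>For \<open>l k = 0\<close> the mode and the uncancelled quotient differ at
      \<open>z = 0\<close>, so this point is excluded as well.\<close>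
    moreover have "\<forall>\<^sub>F z in at ?s. z \<noteq> 0" by (rule eventually_neq_at_within)
    ultimately have "\<forall>\<^sub>F z in at ?s. spectral_matrix U (\<lambda>k. swing_mode M D (l k) z) $ i $ j = ?R z $ i $ j"
    proof eventually_elim
      case (elim z)
      then show ?case
        using swing_transfer_matrix[OF assms(3) _ L, of M z D] assms(1) by (simp add: swing_mode_eq)
    qed
    moreover have "((\<lambda>z. spectral_matrix U (\<lambda>k. swing_mode M D (l k) z) $ i $ j)
        \<longlongrightarrow> spectral_matrix U (\<lambda>k. swing_mode M D (l k) ?s) $ i $ j) (at ?s)"
      unfolding spectral_matrix_entry
      by (intro tendsto_intros swing_mode_isCont[OF assms(1,2), unfolded isCont_def])
    ultimately show "((\<lambda>z. ?R z $ i $ j) \<longlongrightarrow> spectral_matrix U (\<lambda>k. swing_mode M D (l k) ?s) $ i $ j) (at ?s)"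
      by (rule Lim_transform_eventually[rotated])
  qed
  then show ?thesis by (simp add: vec_eq_iff transfer_function_def)
qed

section \<open>From modes to system norms\<close>

lemma has_bochner_integral_spectral_matrix:
  fixes U :: "real^'n^'n" and f :: "'n \<Rightarrow> 'a \<Rightarrow> real"
  assumes U: "orthogonal_matrix U" and f: "\<And>k. has_bochner_integral N (f k) c"
  shows "has_bochner_integral N (\<lambda>w. spectral_matrix U (\<lambda>k. complex_of_real (f k w))) (mat (complex_of_real c))"
proof -
  \<comment> \<open>The projection onto column \<open>k\<close> of \<open>U\<close>. The integrand
    is a combination of these constant matrices, and with the common integral \<open>c\<close> they
    sum to \<open>c\<close> times the identity.\<close>
  let ?P = "\<lambda>k. spectral_matrix U (\<lambda>m. if m = k then 1 else 0)"
  have entry: "spectral_matrix U (\<lambda>k. complex_of_real (r k)) = (\<Sum>k\<in>UNIV. r k *\<^sub>R ?P k)" for r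
    by (simp add: vec_eq_iff spectral_matrix_entry if_distrib[where f = "\<lambda>a. a * b" for b]
        if_distrib[where f = "\<lambda>a. b * a" for b] cong: if_cong)
       (simp add: scaleR_conv_of_real mult_ac)
  have "has_bochner_integral N (\<lambda>w. \<Sum>k\<in>UNIV. f k w *\<^sub>R ?P k) (\<Sum>k\<in>UNIV. c *\<^sub>R ?P k)"
    by (intro has_bochner_integral_sum has_bochner_integral_scaleR_left f)
  then show ?thesis
    unfolding entry[symmetric] spectral_matrix_const[OF U] .
qed

lemma laplacian_diagonalization:
  fixes E :: "'n::finite set set" and B :: "'n \<Rightarrow> 'n \<Rightarrow> real"
  assumes "weighted_graph E B"
  obtains U :: "real^'n^'n" and l :: "'n \<Rightarrow> real" and k0
  where "orthogonal_matrix U"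
    "map_matrix complex_of_real (laplacian E B) = spectral_matrix U (\<lambda>k. complex_of_real (l k))"
    "\<And>k. l k \<ge> 0" "l k0 = 0"
proof -
  let ?L = "laplacian E B"
  obtain U l where U: "orthogonal_matrix U" and eig: "\<And>k. ?L *v column k U = l k *\<^sub>R column k U"
    using symmetric_matrix_diagonalization[OF transpose_laplacian[OF assms]] by blast
  have "(?L ** U) $ i $ k = (?L *v column k U) $ i" for i k
    by (simp add: matrix_matrix_mult_def matrix_vector_mult_def column_def)
  then have "?L ** U = U ** diag_mat l"
    by (simp add: vec_eq_iff eig mult_diag_mat_entry) (simp add: column_def mult.commute)
  then have L: "?L = U ** diag_mat l ** transpose U"
    using U by (metis matrix_mul_assoc matrix_mul_rid orthogonal_matrix_def)
  have "map_matrix complex_of_real ?L $ i $ j = spectral_matrix U (\<lambda>k. complex_of_real (l k)) $ i $ j" for i j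
    by (simp add: L spectral_matrix_entry) (simp add: matrix_matrix_mult_def[of "U ** _"] mult_diag_mat_entry transpose_def)
  then have spec: "map_matrix complex_of_real ?L = spectral_matrix U (\<lambda>k. complex_of_real (l k))"
    by (simp add: vec_eq_iff)
  have nonneg: "l k \<ge> 0" for k
  proof -
    have "norm (column k U) = 1" using U by (simp add: orthogonal_matrix_orthonormal_columns)
    then show ?thesis
      using laplacian_psd[OF assms, of "column k U"] by (simp add: eig dot_square_norm)
  qed
  \<comment> \<open>The all-ones vector in eigenvector coordinates. It is annihilated by the
    Laplacian, so \<open>l k * y $ k = 0\<close> for every \<open>k\<close>; a nonzero coordinate of
    \<open>y\<close> exhibits a zero eigenvalue.\<close>
  define y where "y = transpose U *v (1 :: real^'n)"
  have "U *v y = 1"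
    using U by (simp only: y_def matrix_vector_mul_assoc orthogonal_matrix_def matrix_vector_mul_lid)
  then obtain k0 where k0: "y $ k0 \<noteq> 0"
    by (metis matrix_vector_mult_0_right vec_eq_iff zero_index zero_neq_one)
  have "?L *v 1 = 0" by (simp add: vec_eq_iff laplacian_mult_vec)
  then have "transpose U *v (?L *v 1) = 0" by simp
  moreover have "transpose U *v (?L *v 1) = diag_mat l *v y"
    using U by (simp only: y_def L matrix_vector_mul_assoc matrix_mul_assoc orthogonal_matrix_def matrix_mul_lid)
  ultimately have "(diag_mat l *v y) $ k0 = 0" by simp
  then have "l k0 = 0" using k0 by (simp add: diag_mat_mult_vec_entry)
  with U spec nonneg that show thesis by blast
qed

theorem theorem4:
  fixes M D :: real and E :: "'n::finite set set" and B :: "'n \<Rightarrow> 'n \<Rightarrow> real"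
    and G :: "complex \<Rightarrow> complex^'n^'n"
  assumes "M > 0" and "D > 0"
    and "weighted_graph E B"
    and "G = transfer_function (swing_A M D (laplacian E B)) (swing_F M) freq_output"
  shows "h2_norm G = ereal (sqrt (real CARD('n) / (2 * D * M))) \<and>
         hinf_norm G = ereal (1 / D)"
proof -
  obtain U :: "real^'n^'n" and l k0 where U: "orthogonal_matrix U"
    and L: "map_matrix complex_of_real (laplacian E B) = spectral_matrix U (\<lambda>k. complex_of_real (l k))"
    and l: "\<And>k. l k \<ge> 0" "l k0 = 0"
    using laplacian_diagonalization[OF assms(3)] by blast
  \<comment> \<open>The squared gains of the modes, which are the eigenvalues of \<open>G* G\<close>
    at frequency \<open>w\<close>.\<close>
  define p where "p k w = (norm (swing_mode M D (l k) (\<i> * complex_of_real w)))\<^sup>2" for k w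
  have cnj_mult: "cnj z * z = complex_of_real ((norm z)\<^sup>2)" for z
    unfolding complex_norm_square by (rule mult.commute)
  have P: "conj_transpose (G (\<i> * complex_of_real w)) ** G (\<i> * complex_of_real w) =
      spectral_matrix U (\<lambda>k. complex_of_real (p k w))" for w
    unfolding assms(4) swing_transfer_function[OF assms(1,2) U L]
      conj_transpose_spectral_matrix spectral_matrix_mult[OF U] p_def cnj_mult ..
  have "has_bochner_integral lborel (\<lambda>w. spectral_matrix U (\<lambda>k. complex_of_real (p k w)))
      (mat (complex_of_real (pi / (D * M))))"
    unfolding p_def
    by (intro has_bochner_integral_spectral_matrix U has_bochner_integral_swing_mode assms(1,2) l)
  then have "h2_norm G = ereal (sqrt (1 / (2 * pi) * Re (trace (mat (complex_of_real (pi / (D * M))) :: complex^'n^'n))))"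
    unfolding h2_norm_def Let_def P by (simp add: has_bochner_integral_iff)
  \<comment> \<open>All modes carry equal energy, so the integral is a scalar matrix and the trace
    contributes the factor \<open>CARD('n)\<close>.\<close>
  also have "trace (mat (complex_of_real (pi / (D * M))) :: complex^'n^'n) = of_real (CARD('n) * pi / (D * M))"
    by (simp add: trace_def mat_def)
  also have "1 / (2 * pi) * Re (of_real (CARD('n) * pi / (D * M))) = CARD('n) / (2 * D * M)"
    using assms(1,2) by (simp add: field_simps)
  finally have h2: "h2_norm G = ereal (sqrt (real CARD('n) / (2 * D * M)))" .

  have hinf: "hinf_norm G = (SUP w. ereal (sqrt (Max (range (\<lambda>k. p k w)))))"
    unfolding hinf_norm_def P lambda_max_spectral_matrix[OF U] ..
  have "hinf_norm G \<le> ereal (1 / D)"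
    unfolding hinf
  proof (intro SUP_least)
    fix w
    have "Max (range (\<lambda>k. p k w)) \<le> (1 / D)\<^sup>2"
      unfolding p_def using norm_swing_mode_le[OF assms(2)] by (intro Max.boundedI) auto
    then show "ereal (sqrt (Max (range (\<lambda>k. p k w)))) \<le> ereal (1 / D)"
      using assms(2) by (simp add: real_le_lsqrt)
  qed
  \<comment> \<open>At frequency \<open>0\<close> the mode \<open>k0\<close> with eigenvalue
    \<open>0\<close> has gain exactly \<open>1 / D\<close>.\<close>
  moreover have "ereal (1 / D) \<le> hinf_norm G"
    unfolding hinf
  proof (rule SUP_upper2[of 0])
    have "(1 / D)\<^sup>2 = p k0 0"
      by (simp add: p_def l norm_swing_mode power_divide del: of_real_0)
    also have "\<dots> \<le> Max (range (\<lambda>k. p k 0))" by (intro Max_ge) auto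
    finally show "ereal (1 / D) \<le> ereal (sqrt (Max (range (\<lambda>k. p k 0))))"
      by (simp add: real_le_rsqrt)
  qed simp
  ultimately show ?thesis using h2 by simp
qed

end
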